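(* Let $G$ be an $(n,d,\lambda)$-graph with $d=o(n)$, and let $U\subset V(G)$ be a set of vertices. Assume that $\lambda n/d=o(|U|)$. Then the VC-dimension of $\mathcal{H}(U)$ is at least $2$.
   Context: An $(n,d,\lambda)$-graph is a $d$-regular graph on $n$ vertices all of whose adjacency eigenvalues other than the largest have absolute value at most $\lambda$. We write $u\sim v$ if $u$ and $v$ are adjacent. Asymptotic notation ($o(\cdot)$) refers to a sequence of such graphs and vertex sets with $n\to\infty$. For $U\subset V(G)$ and $v\in U$, let $h_v\colon U\to\{0,1\}$ be given by $h_v(u)=1$ if $u\sim v$ and $h_v(u)=0$ otherwise ($u\in U$), and $\mathcal{H}(U)=\{h_v: v\in U\}$. A collection $\mathcal{H}$ of functions $V\to\{0,1\}$ shatters a finite set $X\subset V$ if the restrictions of the functions in $\mathcal{H}$ to $X$ give every function $X\to\{0,1\}$; the VC-dimension of $\mathcal{H}$ is the largest size of a set shattered by $\mathcal{H}$. *)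

theory Defs
  imports
    "Graph_Theory.Pair_Digraph"
    "Jordan_Normal_Form.Char_Poly"
    "HOL-Library.Extended_Nat"
    "HOL-Library.FuncSet"
    "HOL-Library.Landau_Symbols"
begin

definition graph_adj_mat :: "'a pair_pre_digraph \<Rightarrow> 'a list \<Rightarrow> real mat" where
  "graph_adj_mat G vs = mat (length vs) (length vs)
     (\<lambda>(i, j). if (vs ! i, vs ! j) \<in> parcs G then 1 else 0)"

text \<open>
  Eigenvalues counted with algebraic multiplicity. The adjacency matrix of a graph is symmetric,
  so all complex roots of its characteristic polynomial are real. The choice of the enumeration
  of the vertices is immaterial, see \<open>adj_eigenvalues_eq\<close> below.
\<close>

definition adj_eigenvalues :: "'a pair_pre_digraph \<Rightarrow> real multiset" where
  "adj_eigenvalues G =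
     proots (char_poly (graph_adj_mat G (SOME vs. distinct vs \<and> set vs = pverts G)))"

lemma char_poly_graph_adj_mat_cong:
  assumes vs: "distinct vs" and ws: "distinct ws" and eq: "set vs = set ws"
  shows "char_poly (graph_adj_mat G vs) = char_poly (graph_adj_mat G ws)"
proof -
  define n where "n = length vs"
  have n: "length vs = n" "length ws = n"
    using distinct_card[OF vs] distinct_card[OF ws] eq by (auto simp: n_def)
  define P :: "real mat" where "P = mat n n (\<lambda>(i, j). if vs ! i = ws ! j then 1 else 0)"
  define Q :: "real mat" where "Q = mat n n (\<lambda>(i, j). if ws ! i = vs ! j then 1 else 0)"
  have "\<exists>j<n. ws ! j = vs ! i" if "i < n" for i
    using that eq n by (metis in_set_conv_nth nth_mem)
  then obtain f where f: "\<And>i. i < n \<Longrightarrow> f i < n \<and> ws ! f i = vs ! i" by metis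
  have "\<exists>j<n. vs ! j = ws ! i" if "i < n" for i
    using that eq n by (metis in_set_conv_nth nth_mem)
  then obtain g where g: "\<And>i. i < n \<Longrightarrow> g i < n \<and> vs ! g i = ws ! i" by metis
  have P: "P $$ (i, j) = (if j = f i then 1 else 0)" if "i < n" "j < n" for i j
    using that f[of i] ws n by (auto simp: P_def nth_eq_iff_index_eq)
  have Q: "Q $$ (i, j) = (if j = g i then 1 else 0)" if "i < n" "j < n" for i j
    using that g[of i] vs n by (auto simp: Q_def nth_eq_iff_index_eq)
  have Q': "Q $$ (i, j) = (if i = f j then 1 else 0)" if "i < n" "j < n" for i j
    using that f[of j] nth_eq_iff_index_eq[OF ws, of i "f j"] n by (auto simp: Q_def)
  have dims: "dim_row P = n" "dim_col P = n" "dim_row Q = n" "dim_col Q = n"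
    by (simp_all add: P_def Q_def)
  have PM: "(P * M) $$ (i, j) = M $$ (f i, j)"
    if "i < n" "j < n" "M \<in> carrier_mat n n" for M i j
  proof -
    have "(P * M) $$ (i, j) = (\<Sum>k<n. (if k = f i then 1 else 0) * M $$ (k, j))"
      using that dims by (auto simp: scalar_prod_def lessThan_atLeast0 P intro!: sum.cong)
    also have "\<dots> = (\<Sum>k<n. if k = f i then M $$ (k, j) else 0)"
      by (intro sum.cong) auto
    also have "\<dots> = M $$ (f i, j)" using f that by simp
    finally show ?thesis .
  qed
  have QM: "(Q * M) $$ (i, j) = M $$ (g i, j)"
    if "i < n" "j < n" "M \<in> carrier_mat n n" for M i j
  proof -
    have "(Q * M) $$ (i, j) = (\<Sum>k<n. (if k = g i then 1 else 0) * M $$ (k, j))"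
      using that dims by (auto simp: scalar_prod_def lessThan_atLeast0 Q intro!: sum.cong)
    also have "\<dots> = (\<Sum>k<n. if k = g i then M $$ (k, j) else 0)"
      by (intro sum.cong) auto
    also have "\<dots> = M $$ (g i, j)" using g that by simp
    finally show ?thesis .
  qed
  have MQ: "(M * Q) $$ (i, j) = M $$ (i, f j)"
    if "i < n" "j < n" "M \<in> carrier_mat n n" for M i j
  proof -
    have "(M * Q) $$ (i, j) = (\<Sum>k<n. M $$ (i, k) * (if k = f j then 1 else 0))"
      using that dims by (auto simp: scalar_prod_def lessThan_atLeast0 Q' intro!: sum.cong)
    also have "\<dots> = (\<Sum>k<n. if k = f j then M $$ (i, k) else 0)"
      by (intro sum.cong) auto
    also have "\<dots> = M $$ (i, f j)" using f that by simp
    finally show ?thesis .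
  qed
  have carr: "P \<in> carrier_mat n n" "Q \<in> carrier_mat n n"
    "graph_adj_mat G vs \<in> carrier_mat n n" "graph_adj_mat G ws \<in> carrier_mat n n"
    by (auto simp: P_def Q_def graph_adj_mat_def n)
  have "similar_mat (graph_adj_mat G vs) (graph_adj_mat G ws)"
  proof (rule similar_matI)
    show "{graph_adj_mat G vs, graph_adj_mat G ws, P, Q} \<subseteq> carrier_mat n n" using carr by simp
    show "P * Q = 1\<^sub>m n"
    proof (rule eq_matI)
      fix i j assume "i < dim_row (1\<^sub>m n)" "j < dim_col (1\<^sub>m n)"
      then show "(P * Q) $$ (i, j) = 1\<^sub>m n $$ (i, j)"
        using f[of i] vs n by (simp add: PM carr) (auto simp: Q_def nth_eq_iff_index_eq)
    qed (simp_all add: dims)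
    show "Q * P = 1\<^sub>m n"
    proof (rule eq_matI)
      fix i j assume "i < dim_row (1\<^sub>m n)" "j < dim_col (1\<^sub>m n)"
      then show "(Q * P) $$ (i, j) = 1\<^sub>m n $$ (i, j)"
        using g[of i] ws n by (simp add: QM carr) (auto simp: P_def nth_eq_iff_index_eq)
    qed (simp_all add: dims)
    show "graph_adj_mat G vs = P * graph_adj_mat G ws * Q"
    proof (rule eq_matI)
      fix i j assume "i < dim_row (P * graph_adj_mat G ws * Q)" "j < dim_col (P * graph_adj_mat G ws * Q)"
      then have ij: "i < n" "j < n" by (simp_all add: dims)
      have "(P * graph_adj_mat G ws * Q) $$ (i, j) = graph_adj_mat G ws $$ (f i, f j)"
        using ij f[of j] carr
        by (subst MQ) (auto simp: PM simp del: index_mult_mat(1))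
      also have "\<dots> = graph_adj_mat G vs $$ (i, j)"
        using ij f[of i] f[of j] by (simp add: graph_adj_mat_def n)
      finally show "graph_adj_mat G vs $$ (i, j) = (P * graph_adj_mat G ws * Q) $$ (i, j)" by simp
    qed (use carr in auto)
  qed
  then show ?thesis by (rule char_poly_similar)
qed

lemma adj_eigenvalues_eq:
  assumes "distinct vs" and "set vs = pverts G"
  shows "adj_eigenvalues G = proots (char_poly (graph_adj_mat G vs))"
proof -
  let ?ws = "SOME vs. distinct vs \<and> set vs = pverts G"
  have "distinct ?ws \<and> set ?ws = pverts G"
    by (rule someI[of _ vs]) (use assms in simp)
  then have "char_poly (graph_adj_mat G ?ws) = char_poly (graph_adj_mat G vs)"
    using assms by (intro char_poly_graph_adj_mat_cong) auto
  then show ?thesis by (simp add: adj_eigenvalues_def)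
qed

text \<open>
  A \<^const>\<open>pair_graph\<close> is a finite simple graph, each edge being a pair of opposite arcs, so the
  out-degree is the degree. Only one copy of the largest eigenvalue is removed: if it is a
  multiple eigenvalue, the bound applies to its remaining copies.
\<close>

definition nd_lambda_graph :: "nat \<Rightarrow> nat \<Rightarrow> real \<Rightarrow> 'a pair_pre_digraph \<Rightarrow> bool" where
  "nd_lambda_graph n d l G \<longleftrightarrow>
     pair_graph G \<and> card (pverts G) = n \<and>
     (\<forall>v \<in> pverts G. out_degree (with_proj G) v = d) \<and>
     (\<forall>\<mu> \<in># adj_eigenvalues G - {# Max (set_mset (adj_eigenvalues G)) #}. \<bar>\<mu>\<bar> \<le> l)"

definition nbr_fun :: "'a pair_pre_digraph \<Rightarrow> 'a set \<Rightarrow> 'a \<Rightarrow> 'a \<Rightarrow> nat" where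
  "nbr_fun G U v = (\<lambda>u\<in>U. if (u, v) \<in> parcs G then 1 else 0)"

definition nbr_class :: "'a pair_pre_digraph \<Rightarrow> 'a set \<Rightarrow> ('a \<Rightarrow> nat) set" where
  "nbr_class G U = nbr_fun G U ` U"

definition shatters :: "('a \<Rightarrow> nat) set \<Rightarrow> 'a set \<Rightarrow> bool" where
  "shatters H X \<longleftrightarrow> finite X \<and> (\<lambda>h. restrict h X) ` H = X \<rightarrow>\<^sub>E {0, 1}"

text \<open>
  \<open>V\<close> is the common domain of the functions in \<open>H\<close>. The supremum is \<open>\<infinity>\<close> if the sizes of shattered
  sets are unbounded, and \<open>0\<close> if \<open>H\<close> is empty (then not even the empty set is shattered).
\<close>

definition vc_dim :: "'a set \<Rightarrow> ('a \<Rightarrow> nat) set \<Rightarrow> enat" where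
  "vc_dim V H = (SUP X \<in> {X. X \<subseteq> V \<and> shatters H X}. enat (card X))"

end

theory Submission
  imports Defs "HOL-Analysis.Function_Topology" "HOL-Analysis.Convex"
begin

text \<open>
  Write \<open>D = d |U| / n\<close>; the hypothesis says \<open>l = o(D)\<close>. By the expander mixing lemma, all but a
  small fraction of the vertices of \<open>U\<close> have between \<open>D / 2\<close> and \<open>2 D\<close> neighbours in \<open>U\<close>, and some
  such typical vertex \<open>v\<close> has at least \<open>D / 2\<close> typical neighbours. Let \<open>x\<close> be one of them. Mixing
  between \<open>N(x) \<inter> U\<close> and the set of \<open>y \<in> U\<close> having at least \<open>D / 2\<close> neighbours in it shows that there
  are only \<open>O(l\<^sup>2 / D)\<close>, hence fewer than \<open>D / 2\<close>, such \<open>y\<close>; so \<open>v\<close> has another typical neighbour \<open>y\<close>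
  for which \<open>x\<close> and \<open>y\<close> have fewer than \<open>D / 2\<close> common neighbours in \<open>U\<close>. Then neither neighbourhood
  in \<open>U\<close> contains the other, they meet in \<open>v\<close>, and they do not cover \<open>U\<close> because \<open>4 D < |U|\<close>: the
  pair \<open>{x, y}\<close> is shattered.

  The mixing lemma needs that the operator norm of \<open>A - (d / n) J\<close> is at most \<open>l\<close>. The norm of a
  symmetric operator is attained at an eigenvector, by compactness of the unit sphere, and
  eigenvectors of \<open>A - (d / n) J\<close> for a nonzero eigenvalue are eigenvectors of \<open>A\<close> orthogonal to the
  constants; the eigenvalue \<open>d\<close> cannot occur there, since it would then be a multiple root of the
  characteristic polynomial, forcing \<open>d \<le> l\<close>.
\<close>

section \<open>Operator norm of a symmetric kernel on a finite set\<close>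

text \<open>For small \<open>t\<close> of the sign of \<open>p\<close> the linear term would
  dominate. This serves as the first-order condition at a maximum, without derivatives.\<close>

lemma real_linear_coeff_eq_0:
  fixes p q :: real
  assumes "\<And>t. 2 * t * p \<le> t\<^sup>2 * q"
  shows "p = 0"
proof (rule ccontr)
  assume p: "p \<noteq> 0"
  define Q where "Q = \<bar>q\<bar> + 1"
  have Q: "Q > 0" "q \<le> Q" by (auto simp: Q_def)
  have "2 * (p / Q) * p \<le> (p / Q)\<^sup>2 * q" by (rule assms)
  also have "\<dots> \<le> (p / Q)\<^sup>2 * Q" using Q by (intro mult_left_mono) auto
  finally have "2 * p\<^sup>2 / Q \<le> p\<^sup>2 / Q" using Q by (simp add: power2_eq_square)
  then show False using p Q by (simp add: divide_le_cancel)
qed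

text \<open>Functions on \<open>V\<close> are extended by zero, so the sphere is a closed subset of
  a product of compact sets and Tychonoff's theorem applies.\<close>

lemma compact_unit_sphere_fun:
  fixes V :: "'a set"
  assumes "finite V"
  shows "compact {f :: 'a \<Rightarrow> real. (\<forall>v. v \<notin> V \<longrightarrow> f v = 0) \<and> (\<Sum>v\<in>V. (f v)\<^sup>2) = 1}"
proof -
  define P :: "('a \<Rightarrow> real) set" where "P = PiE UNIV (\<lambda>v. if v \<in> V then {-1..1} else {0})"
  have "compactin (product_topology (\<lambda>_. euclidean) UNIV) P"
    unfolding P_def compactin_PiE by auto
  then have "compact P" by (simp add: euclidean_product_topology)
  moreover have "closed {f :: 'a \<Rightarrow> real. (\<Sum>v\<in>V. (f v)\<^sup>2) = 1}"
    by (intro closed_Collect_eq continuous_intros) (simp_all add: continuous_on_product_coordinates)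
  ultimately have "compact (P \<inter> {f. (\<Sum>v\<in>V. (f v)\<^sup>2) = 1})" by (rule compact_Int_closed)
  moreover have "P \<inter> {f. (\<Sum>v\<in>V. (f v)\<^sup>2) = 1}
      = {f. (\<forall>v. v \<notin> V \<longrightarrow> f v = 0) \<and> (\<Sum>v\<in>V. (f v)\<^sup>2) = 1}"
  proof -
    have "\<bar>f v\<bar> \<le> 1" if "(\<Sum>v\<in>V. (f v)\<^sup>2) = 1" "v \<in> V" for f :: "'a \<Rightarrow> real" and v
    proof -
      have "(f v)\<^sup>2 \<le> (\<Sum>v\<in>V. (f v)\<^sup>2)" using assms that by (intro member_le_sum) auto
      then show ?thesis using that by (simp add: abs_square_le_1)
    qed
    moreover have "f \<in> P \<longleftrightarrow> (\<forall>v. if v \<in> V then \<bar>f v\<bar> \<le> 1 else f v = 0)" for f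
      by (simp add: P_def PiE_iff if_distrib[of "\<lambda>X. _ \<in> X"] abs_le_iff minus_le_iff conj_commute
          cong: if_cong)
    ultimately show ?thesis by auto
  qed
  ultimately show ?thesis by simp
qed

text \<open>Here \<open>ev\<close> bounds all real eigenvalues. A maximiser \<open>f\<close> of the
  norm of \<open>T f\<close> on the unit sphere is an eigenvector of \<open>T\<close> applied twice,
  with the maximum \<open>M\<close> as eigenvalue.\<close>

lemma symmetric_kernel_norm_le:
  fixes B :: "'a \<Rightarrow> 'a \<Rightarrow> real" and g :: "'a \<Rightarrow> real"
  assumes fin: "finite V"
    and sym: "\<And>v w. v \<in> V \<Longrightarrow> w \<in> V \<Longrightarrow> B v w = B w v"
    and ev: "\<And>\<mu> f v. (\<And>v. v \<in> V \<Longrightarrow> (\<Sum>w\<in>V. B v w * f w) = \<mu> * f v) \<Longrightarrow>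
               v \<in> V \<Longrightarrow> f v \<noteq> 0 \<Longrightarrow> \<bar>\<mu>\<bar> \<le> l"
  shows "(\<Sum>v\<in>V. (\<Sum>w\<in>V. B v w * g w)\<^sup>2) \<le> l\<^sup>2 * (\<Sum>v\<in>V. (g v)\<^sup>2)"
proof (cases "V = {}")
  case False
  define T where "T f v = (\<Sum>w\<in>V. B v w * f w)" for f :: "'a \<Rightarrow> real" and v
  define N where "N f = (\<Sum>v\<in>V. (f v)\<^sup>2)" for f :: "'a \<Rightarrow> real"
  define ip where "ip f g = (\<Sum>v\<in>V. f v * g v)" for f g :: "'a \<Rightarrow> real"
  define K :: "('a \<Rightarrow> real) set" where
    "K = {f. (\<forall>v. v \<notin> V \<longrightarrow> f v = 0) \<and> (\<Sum>v\<in>V. (f v)\<^sup>2) = 1}"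
  have compK: "compact K" unfolding K_def by (rule compact_unit_sphere_fun[OF fin])
  obtain v0 where v0: "v0 \<in> V" using False by blast
  have "(\<lambda>v. if v = v0 then 1 else 0) \<in> K"
    using v0 fin by (auto simp: K_def if_distrib[of "\<lambda>x. x\<^sup>2"] cong: if_cong)
  then have neK: "K \<noteq> {}" by blast
  have "continuous_on K (\<lambda>f. N (T f))"
    unfolding N_def T_def
    by (intro continuous_intros continuous_on_subset[OF continuous_on_product_coordinates]) auto
  then obtain f where f: "f \<in> K" and fmax: "\<And>h. h \<in> K \<Longrightarrow> N (T h) \<le> N (T f)"
    using continuous_attains_sup[OF compK neK] by blast
  define M where "M = N (T f)"
  have Nf: "N f = 1" using f by (simp add: K_def N_def)
  have M0: "M \<ge> 0" unfolding M_def N_def by (intro sum_nonneg) auto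
  have le: "N (T h) \<le> M * N h" for h
  proof (cases "N h = 0")
    case True
    then have "\<forall>v\<in>V. h v = 0" using fin by (simp add: N_def sum_nonneg_eq_0_iff)
    then have "N (T h) = 0" by (simp add: N_def T_def)
    then show ?thesis using True by simp
  next
    case False
    moreover have "N h \<ge> 0" unfolding N_def by (intro sum_nonneg) auto
    ultimately have pos: "N h > 0" by simp
    \<comment> \<open>Besides normalising, \<open>h'\<close> cuts \<open>h\<close> off outside
      \<open>V\<close>, as membership in \<open>K\<close> requires; \<open>T\<close> does not see
      the difference.\<close>
    define h' where "h' v = (if v \<in> V then h v / sqrt (N h) else 0)" for v
    have "(\<Sum>v\<in>V. (h' v)\<^sup>2) = (\<Sum>v\<in>V. (h v)\<^sup>2 / N h)"
      using pos by (intro sum.cong) (auto simp: h'_def power_divide)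
    also have "\<dots> = 1" using pos by (simp add: N_def flip: sum_divide_distrib)
    finally have "h' \<in> K" by (auto simp: K_def h'_def)
    then have "N (T h') \<le> M" using fmax by (simp add: M_def)
    moreover have "T h' v = T h v / sqrt (N h)" for v
      by (simp add: T_def h'_def sum_divide_distrib)
    then have "N (T h') = N (T h) / N h"
      using pos by (simp add: N_def[of "T h'"] N_def[of "T h"] power_divide sum_divide_distrib)
    ultimately show ?thesis using pos by (simp add: divide_le_eq)
  qed
  have Nadd: "N (\<lambda>v. f v + t * h v) = N f + 2 * t * ip f h + t\<^sup>2 * N h" for f h t
    by (simp add: N_def ip_def sum_distrib_left flip: sum.distrib)
       (intro sum.cong, auto simp: power2_eq_square algebra_simps)
  have Tadd: "T (\<lambda>v. f v + t * h v) = (\<lambda>v. T f v + t * T h v)" for f h t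
    by (intro ext) (simp add: T_def sum_distrib_left algebra_simps flip: sum.distrib)
  \<comment> \<open>In \<open>le\<close> for the perturbation \<open>f + t h\<close> the constant
    terms cancel, because \<open>f\<close> attains \<open>M\<close>; hence the coefficient of
    \<open>t\<close> vanishes.\<close>
  have var: "ip (T f) (T h) = M * ip f h" for h
  proof -
    have "ip (T f) (T h) - M * ip f h = 0"
    proof (rule real_linear_coeff_eq_0)
      fix t
      have "N (T (\<lambda>v. f v + t * h v)) \<le> M * N (\<lambda>v. f v + t * h v)" by (rule le)
      then show "2 * t * (ip (T f) (T h) - M * ip f h) \<le> t\<^sup>2 * (M * N h - N (T h))"
        by (simp add: Tadd Nadd Nf flip: M_def) (simp add: algebra_simps)
    qed
    then show ?thesis by simp
  qed
  have TT: "T (T f) v = M * f v" if v: "v \<in> V" for v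
  proof -
    \<comment> \<open>Testing \<open>var\<close> against a point mass at \<open>v\<close> gives the
      pointwise identity; by symmetry \<open>T e\<close> is the row of \<open>B\<close> at
      \<open>v\<close>.\<close>
    define e where "e = (\<lambda>w. if w = v then 1 else 0 :: real)"
    have "T e w = B v w" if "w \<in> V" for w
      using v that fin sym by (simp add: T_def e_def if_distrib[of "\<lambda>x. _ * x"] cong: if_cong)
    then have "T (T f) v = ip (T f) (T e)"
      by (simp add: T_def[of "T f"] ip_def mult.commute)
    also have "\<dots> = M * ip f e" by (rule var)
    also have "ip f e = f v"
      using v fin by (simp add: ip_def e_def if_distrib[of "\<lambda>x. _ * x"] cong: if_cong)
    finally show ?thesis .
  qed
  define s where "s = sqrt M"
  have s: "s * s = M" "s \<ge> 0" using M0 by (auto simp: s_def)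
  \<comment> \<open>\<open>0 = T\<^sup>2 f - s\<^sup>2 f = (T - s) (T f + s f)\<close>, so \<open>s\<close> or \<open>-s\<close> is an eigenvalue.\<close>
  have "\<bar>s\<bar> \<le> l"
  proof (cases "\<forall>v\<in>V. T f v + s * f v = 0")
    case True
    obtain v where "v \<in> V" "f v \<noteq> 0"
      using Nf by (metis N_def sum.neutral zero_neq_one zero_power2)
    moreover have "(\<Sum>w\<in>V. B v w * f w) = (- s) * f v" if "v \<in> V" for v
      using True that by (auto simp: T_def add_eq_0_iff2)
    ultimately have "\<bar>- s\<bar> \<le> l" using ev by blast
    then show ?thesis by simp
  next
    case False
    then obtain v where "v \<in> V" "T f v + s * f v \<noteq> 0" by blast
    moreover have "(\<Sum>w\<in>V. B v w * (T f w + s * f w)) = s * (T f v + s * f v)" if "v \<in> V" for v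
    proof -
      have "(\<Sum>w\<in>V. B v w * (T f w + s * f w)) = T (\<lambda>w. T f w + s * f w) v" by (simp add: T_def)
      also have "\<dots> = M * f v + s * T f v" using that by (simp add: Tadd TT)
      finally show ?thesis using s by (simp add: algebra_simps)
    qed
    ultimately show ?thesis using ev[of "\<lambda>w. T f w + s * f w" s v] by blast
  qed
  then have "M \<le> l\<^sup>2" using s power_mono[of s l 2] by (simp add: power2_eq_square)
  moreover have "N g \<ge> 0" unfolding N_def by (intro sum_nonneg) auto
  ultimately have "N (T g) \<le> l\<^sup>2 * N g"
    using le[of g] mult_right_mono[of M "l\<^sup>2" "N g"] by linarith
  then show ?thesis by (simp add: N_def T_def)
qed simp

section \<open>Independent eigenvectors and multiple roots of the characteristic polynomial\<close>

text \<open>Cramer's rule for the matrix \<open>R\<close> that already has \<open>b\<close> in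
  column \<open>k\<close>: it sends \<open>c\<close> times the unit vector to \<open>c\<close> times
  \<open>b\<close>.\<close>

lemma det_replace_col_smult:
  fixes A :: "'b :: comm_ring_1 mat"
  assumes A: "A \<in> carrier_mat n n" and b: "b \<in> carrier_vec n" and k: "k < n"
  shows "det (replace_col A (c \<cdot>\<^sub>v b) k) = c * det (replace_col A b k)"
proof -
  define R where "R = replace_col A b k"
  have R: "R \<in> carrier_mat n n" using A by (auto simp: R_def replace_col_def)
  have x: "c \<cdot>\<^sub>v unit_vec n k \<in> carrier_vec n" by simp
  have "R *\<^sub>v (c \<cdot>\<^sub>v unit_vec n k) = c \<cdot>\<^sub>v b"
  proof (rule eq_vecI)
    fix i assume "i < dim_vec (c \<cdot>\<^sub>v b)"
    then have "i < n" using b by simp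
    then show "(R *\<^sub>v (c \<cdot>\<^sub>v unit_vec n k)) $ i = (c \<cdot>\<^sub>v b) $ i"
      using R A b k by (simp add: row_def R_def replace_col_def)
  qed (use R b in auto)
  then have "det (replace_col R (c \<cdot>\<^sub>v b) k) = c * det R"
    using cramer_lemma_mat[OF R x k] k by simp
  moreover have "replace_col R (c \<cdot>\<^sub>v b) k = replace_col A (c \<cdot>\<^sub>v b) k"
    by (rule eq_matI) (auto simp: R_def replace_col_def)
  ultimately show ?thesis by (simp add: R_def)
qed

text \<open>The eigenvector is lifted to constant polynomials so that Cramer's rule over the
  polynomial ring can produce the factor \<open>[:-e, 1:]\<close>.\<close>

lemma char_poly_matrix_mult_eigenvector:
  fixes A :: "'b :: field mat"
  assumes A: "A \<in> carrier_mat n n" and x: "x \<in> carrier_vec n" and Ax: "A *\<^sub>v x = e \<cdot>\<^sub>v x"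
  shows "char_poly_matrix A *\<^sub>v map_vec (\<lambda>c. [:c:]) x = [:-e, 1:] \<cdot>\<^sub>v map_vec (\<lambda>c. [:c:]) x"
proof (rule eq_vecI)
  let ?x = "map_vec (\<lambda>c. [:c:]) x"
  fix i assume "i < dim_vec ([:-e, 1:] \<cdot>\<^sub>v ?x)"
  then have i: "i < n" using x by simp
  have "(\<Sum>j<n. A $$ (i, j) * x $ j) = (A *\<^sub>v x) $ i"
    using i A x by (auto simp: scalar_prod_def lessThan_atLeast0 intro!: sum.cong)
  then have Axi: "(\<Sum>j<n. A $$ (i, j) * x $ j) = e * x $ i"
    using i x by (simp add: Ax)
  have const: "(\<Sum>j<m. [:h j:]) = [:\<Sum>j<m. h j:]" for h :: "nat \<Rightarrow> 'b" and m
    by (induction m) simp_all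
  have "(char_poly_matrix A *\<^sub>v ?x) $ i = (\<Sum>j<n. char_poly_matrix A $$ (i, j) * [:x $ j:])"
    using i A x
    by (auto simp: scalar_prod_def lessThan_atLeast0 char_poly_matrix_def intro!: sum.cong)
  also have "\<dots> = (\<Sum>j<n. (if j = i then [:0, x $ i:] else 0) - [:A $$ (i, j) * x $ j:])"
    using i A by (intro sum.cong) (auto simp: char_poly_matrix_def)
  also have "\<dots> = [:0, x $ i:] - [:\<Sum>j<n. A $$ (i, j) * x $ j:]"
    using i const by (simp add: sum_subtractf)
  also have "\<dots> = ([:-e, 1:] \<cdot>\<^sub>v ?x) $ i" using i x by (simp add: Axi)
  finally show "(char_poly_matrix A *\<^sub>v ?x) $ i = ([:-e, 1:] \<cdot>\<^sub>v ?x) $ i" .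
qed (use A x in \<open>auto simp: char_poly_matrix_def\<close>)

text \<open>The coordinates \<open>i\<close> and \<open>j\<close> certify that \<open>x\<close> and
  \<open>y\<close> are linearly independent, since the corresponding 2 by 2 minor is
  triangular.\<close>

lemma char_poly_double_root:
  fixes A :: "'b :: field mat"
  assumes A: "A \<in> carrier_mat n n"
    and x: "x \<in> carrier_vec n" "A *\<^sub>v x = e \<cdot>\<^sub>v x"
    and y: "y \<in> carrier_vec n" "A *\<^sub>v y = e \<cdot>\<^sub>v y"
    and ij: "i < n" "j < n" "x $ i \<noteq> 0" "y $ i = 0" "y $ j \<noteq> 0"
  shows "[:-e, 1:]\<^sup>2 dvd char_poly A"
proof -
  define C where "C = char_poly_matrix A"
  define X where "X = map_vec (\<lambda>c. [:c:]) x"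
  define Y where "Y = map_vec (\<lambda>c. [:c:]) y"
  have C: "C \<in> carrier_mat n n" using A by (simp add: C_def)
  have X: "X \<in> carrier_vec n" and Y: "Y \<in> carrier_vec n" using x y by (auto simp: X_def Y_def)
  have XY: "X $ i = [:x $ i:]" "Y $ j = [:y $ j:]" using x y ij by (auto simp: X_def Y_def)
  have CX: "C *\<^sub>v X = [:-e, 1:] \<cdot>\<^sub>v X" and CY: "C *\<^sub>v Y = [:-e, 1:] \<cdot>\<^sub>v Y"
    using char_poly_matrix_mult_eigenvector[OF A] x y by (auto simp: C_def X_def Y_def)
  \<comment> \<open>Cramer's rule extracts one factor for each eigenvector; replacing column \<open>i\<close> first does not
    disturb the second eigenvector, as \<open>y $ i = 0\<close>.\<close>
  define C' where "C' = replace_col C X i"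
  have C': "C' \<in> carrier_mat n n" using C by (auto simp: C'_def replace_col_def)
  have "C' *\<^sub>v Y = C *\<^sub>v Y"
  proof (rule eq_vecI)
    fix k assume "k < dim_vec (C *\<^sub>v Y)"
    then show "(C' *\<^sub>v Y) $ k = (C *\<^sub>v Y) $ k"
      using C Y y ij by (auto simp: C'_def replace_col_def scalar_prod_def Y_def intro!: sum.cong)
  qed (use C C' in auto)
  then have C'Y: "C' *\<^sub>v Y = [:-e, 1:] \<cdot>\<^sub>v Y" by (simp add: CY)
  have eq1: "[:x $ i:] * det C = [:-e, 1:] * det C'"
    using cramer_lemma_mat[OF C X ij(1)] det_replace_col_smult[OF C X ij(1)]
    by (simp add: CX C'_def XY del: mult_pCons_left)
  have eq2: "[:y $ j:] * det C' = [:-e, 1:] * det (replace_col C' Y j)"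
    using cramer_lemma_mat[OF C' Y ij(2)] det_replace_col_smult[OF C' Y ij(2)]
    by (simp add: C'Y XY del: mult_pCons_left)
  have "Polynomial.smult (y $ j * x $ i) (det C) = [:y $ j:] * ([:x $ i:] * det C)"
    by (simp add: mult.commute)
  also have "\<dots> = [:-e, 1:] * ([:y $ j:] * det C')" by (simp only: eq1 mult.left_commute)
  also have "\<dots> = [:-e, 1:]\<^sup>2 * det (replace_col C' Y j)"
    by (simp only: eq2 power2_eq_square mult.assoc)
  finally have "[:-e, 1:]\<^sup>2 dvd Polynomial.smult (y $ j * x $ i) (det C)"
    by (simp only: dvd_triv_left)
  then have "[:-e, 1:]\<^sup>2 dvd det C" by (rule dvd_smult_cancel) (use ij in simp)
  then show ?thesis by (simp only: C_def char_poly_def)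
qed

section \<open>The expander mixing lemma\<close>

lemma nd_lambda_graph_card_nbrs:
  assumes G: "nd_lambda_graph n d l G" and v: "v \<in> pverts G"
  shows "card {w \<in> pverts G. (v, w) \<in> parcs G} = d"
proof -
  interpret pair_graph G using G by (simp add: nd_lambda_graph_def)
  have "out_arcs (with_proj G) v = Pair v ` {w \<in> pverts G. (v, w) \<in> parcs G}"
    using in_arcsD2 by (fastforce simp: out_arcs_def)
  then have "out_degree (with_proj G) v = card {w \<in> pverts G. (v, w) \<in> parcs G}"
    by (simp add: out_degree_def card_image inj_on_def)
  then show ?thesis using G v by (simp add: nd_lambda_graph_def)
qed

text \<open>The left-hand side is a bilinear form of the kernel \<open>B\<close> at two indicators,
  bounded by Cauchy-Schwarz and the norm of \<open>B\<close>. The assumption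
  \<open>l < real d\<close> identifies the removed largest eigenvalue as \<open>d\<close>.\<close>

theorem expander_mixing:
  fixes G :: "'a pair_pre_digraph"
  assumes G: "nd_lambda_graph n d l G" and l: "0 \<le> l" "l < real d"
    and S: "S \<subseteq> pverts G" and T: "T \<subseteq> pverts G"
  shows "\<bar>(\<Sum>s\<in>S. real (card {t \<in> T. (s, t) \<in> parcs G})) - real d * card S * card T / n\<bar>
      \<le> l * sqrt (real (card S) * card T)"
proof (cases "pverts G = {}")
  case True
  then show ?thesis using S T by simp
next
  case False
  define V where "V = pverts G"
  interpret pair_graph G using G by (simp add: nd_lambda_graph_def)
  have fin: "finite V" and cardV: "card V = n"
    using G by (auto simp: V_def nd_lambda_graph_def)
  have n: "n > 0" using False fin cardV by (auto simp: V_def card_gt_0_iff)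
  define a :: "'a \<Rightarrow> 'a \<Rightarrow> real" where "a v w = (if (v, w) \<in> parcs G then 1 else 0)" for v w
  have sym: "a v w = a w v" for v w
    using arcs_symmetric[of v w] arcs_symmetric[of w v] by (auto simp: a_def)
  have card_eq: "(\<Sum>w\<in>T. a v w) = card {w \<in> T. (v, w) \<in> parcs G}" if "T \<subseteq> V" for T v
    using finite_subset[OF that fin] by (simp add: a_def sum.If_cases Int_def)
  have reg: "(\<Sum>w\<in>V. a v w) = d" if "v \<in> V" for v
    using nd_lambda_graph_card_nbrs[OF G] that by (simp add: card_eq V_def)
  obtain vs where vs: "distinct vs" "set vs = V" using finite_distinct_list[OF fin] by blast
  have len: "length vs = n" using distinct_card[OF vs(1)] vs(2) cardV by simp
  define A where "A = graph_adj_mat G vs"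
  have A: "A \<in> carrier_mat n n" by (simp add: A_def graph_adj_mat_def len)
  have eig: "adj_eigenvalues G = proots (char_poly A)"
    using adj_eigenvalues_eq vs by (auto simp: A_def V_def)
  have cp: "char_poly A \<noteq> 0" using degree_monic_char_poly[OF A] by auto
  define vec_of where "vec_of f = vec n (\<lambda>i. f (vs ! i))" for f :: "'a \<Rightarrow> real"
  have vec_of: "vec_of f \<in> carrier_vec n" for f by (simp add: vec_of_def)
  have mult: "A *\<^sub>v vec_of f = \<mu> \<cdot>\<^sub>v vec_of f"
    if "\<And>v. v \<in> V \<Longrightarrow> (\<Sum>w\<in>V. a v w * f w) = \<mu> * f v" for f \<mu>
  proof (rule eq_vecI)
    fix i assume "i < dim_vec (\<mu> \<cdot>\<^sub>v vec_of f)"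
    then have i: "i < n" by (simp add: vec_of_def)
    have "(A *\<^sub>v vec_of f) $ i = (\<Sum>j<n. a (vs ! i) (vs ! j) * f (vs ! j))"
      using i A by (auto simp: scalar_prod_def lessThan_atLeast0 vec_of_def A_def graph_adj_mat_def
          len a_def intro!: sum.cong)
    also have "\<dots> = (\<Sum>w\<in>V. a (vs ! i) w * f w)"
      using sum.reindex_bij_betw[OF bij_betw_nth[OF vs(1)], of "{..<n}" V] vs len by simp
    also have "\<dots> = \<mu> * f (vs ! i)" using i that[of "vs ! i"] vs len nth_mem by blast
    finally show "(A *\<^sub>v vec_of f) $ i = (\<mu> \<cdot>\<^sub>v vec_of f) $ i" using i by (simp add: vec_of_def)
  qed (use A in \<open>auto simp: vec_of_def\<close>)
  have eigI: "\<mu> \<in># adj_eigenvalues G"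
    if f: "\<And>v. v \<in> V \<Longrightarrow> (\<Sum>w\<in>V. a v w * f w) = \<mu> * f v" and v: "v \<in> V" "f v \<noteq> 0" for f \<mu> v
  proof -
    obtain i where i: "i < n" "vs ! i = v" using v vs len by (metis in_set_conv_nth)
    then have "vec_of f $ i \<noteq> 0" using v by (simp add: vec_of_def)
    then have "vec_of f \<noteq> 0\<^sub>v n" using i by auto
    then have "eigenvalue A \<mu>"
      using mult[OF f] vec_of A by (auto simp: eigenvalue_def eigenvector_def)
    then show ?thesis using eigenvalue_root_char_poly[OF A] cp by (simp add: eig)
  qed
  \<comment> \<open>The factors 1 stand for the constant function, in the shape that
    \<open>eigI\<close> and \<open>mult\<close> expect.\<close>
  have one: "(\<Sum>w\<in>V. a v w * 1) = real d * 1" if "v \<in> V" for v using reg[OF that] by simp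
  have d_eig: "real d \<in># adj_eigenvalues G" using eigI[OF one] False by (auto simp: V_def)
  let ?m = "Max (set_mset (adj_eigenvalues G))"
  have rest: "\<bar>\<mu>\<bar> \<le> l" if "\<mu> \<in># adj_eigenvalues G - {#?m#}" for \<mu>
    using G that by (auto simp: nd_lambda_graph_def)
  \<comment> \<open>Otherwise \<open>d\<close> would survive the removal of the largest eigenvalue
    and be at most \<open>l\<close>.\<close>
  have max: "?m = real d"
  proof (rule ccontr)
    assume "?m \<noteq> real d"
    then have "real d \<in># adj_eigenvalues G - {#?m#}" using d_eig by (simp add: in_diff_count)
    then show False using rest l by fastforce
  qed
  define B where "B v w = a v w - real d / n" for v w
  have Bf: "(\<Sum>w\<in>T. B v w * f w) = (\<Sum>w\<in>T. a v w * f w) - real d / n * (\<Sum>w\<in>T. f w)" for v f T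
    by (simp add: B_def algebra_simps sum_subtractf sum_distrib_left sum_divide_distrib)
  have B_ev: "\<bar>\<mu>\<bar> \<le> l"
    if f: "\<And>v. v \<in> V \<Longrightarrow> (\<Sum>w\<in>V. B v w * f w) = \<mu> * f v" and v: "v \<in> V" "f v \<noteq> 0" for \<mu> f v
  proof (cases "\<mu> = 0")
    case True
    then show ?thesis using l by simp
  next
    case mu: False
    \<comment> \<open>By regularity the column sums of \<open>B\<close> vanish, so summing the
      eigenvalue equation shows that \<open>f\<close> is orthogonal to the constants.\<close>
    have "\<mu> * (\<Sum>v\<in>V. f v) = (\<Sum>v\<in>V. \<Sum>w\<in>V. B v w * f w)"
      using f by (simp add: sum_distrib_left)
    also have "\<dots> = (\<Sum>w\<in>V. (\<Sum>v\<in>V. B v w) * f w)"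
      by (subst sum.swap) (simp add: sum_distrib_right)
    also have "\<dots> = 0"
    proof (rule sum.neutral, rule ballI)
      fix w assume w: "w \<in> V"
      have "(\<Sum>v\<in>V. B v w) = (\<Sum>v\<in>V. a w v) - d"
        using n cardV by (simp add: B_def sum_subtractf sym[of w])
      then show "(\<Sum>v\<in>V. B v w) * f w = 0" using reg[OF w] by simp
    qed
    finally have sum0: "(\<Sum>v\<in>V. f v) = 0" using mu by simp
    have af: "(\<Sum>w\<in>V. a v w * f w) = \<mu> * f v" if "v \<in> V" for v
      using f[OF that] by (simp add: Bf sum0)
    have mu_eig: "\<mu> \<in># adj_eigenvalues G" using eigI[OF af v] .
    show ?thesis
    proof (cases "\<mu> = real d")
      case False
      then show ?thesis using mu_eig rest[of \<mu>] by (simp add: max in_diff_count)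
    next
      case True
      obtain v' where v': "v' \<in> V" "f v' \<noteq> f v"
      proof (rule ccontr)
        assume "\<not> thesis"
        then have "\<forall>w\<in>V. f w = f v" using that by blast
        then have "(\<Sum>w\<in>V. f w) = n * f v" using cardV by simp
        then show False using sum0 n v by simp
      qed
      obtain i j where ij: "i < n" "vs ! i = v" "j < n" "vs ! j = v'"
        using v v' vs len by (metis in_set_conv_nth)
      \<comment> \<open>Subtracting a constant keeps the eigenvalue \<open>d\<close> and makes
        \<open>g\<close> vanish at \<open>v\<close> but not at \<open>v'\<close>: with the constant
        function this is the independence pattern of \<open>char_poly_double_root\<close>.\<close>
      define g where "g w = f w - f v" for w
      have g: "(\<Sum>w\<in>V. a u w * g w) = real d * g u" if "u \<in> V" for u
      proof -
        have "(\<Sum>w\<in>V. a u w * g w) = (\<Sum>w\<in>V. a u w * f w) - (\<Sum>w\<in>V. a u w) * f v"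
          by (simp add: g_def algebra_simps sum_subtractf sum_distrib_left)
        then show ?thesis using af[OF that] reg[OF that] True by (simp add: g_def algebra_simps)
      qed
      have "[:- real d, 1:]\<^sup>2 dvd char_poly A"
        by (rule char_poly_double_root[OF A vec_of mult[OF one] vec_of mult[OF g] ij(1) ij(3)])
           (use ij v' in \<open>auto simp: vec_of_def g_def\<close>)
      then have "count (adj_eigenvalues G) (real d) \<ge> 2"
        using cp by (simp add: eig order_divides)
      then have "real d \<in># adj_eigenvalues G - {#?m#}" by (simp add: max in_diff_count)
      then show ?thesis using rest True by blast
    qed
  qed
  define iS :: "'a \<Rightarrow> real" where "iS = indicator S"
  define iT :: "'a \<Rightarrow> real" where "iT = indicator T"
  have sub: "S \<subseteq> V" "T \<subseteq> V" using S T by (auto simp: V_def)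
  have sumT: "(\<Sum>w\<in>V. h w * iT w) = (\<Sum>w\<in>T. h w)" for h
    using sub fin by (simp add: iT_def Int_absorb1 flip: sum.inter_restrict)
  have sumS: "(\<Sum>w\<in>V. iS w * h w) = (\<Sum>w\<in>S. h w)" for h
    using sub fin by (simp add: iS_def Int_absorb1 flip: sum.inter_restrict)
  have sqT: "(\<Sum>w\<in>V. (iT w)\<^sup>2) = card T" using sumT[of iT]
    by (simp add: power2_eq_square) (simp add: iT_def)
  have sqS: "(\<Sum>w\<in>V. (iS w)\<^sup>2) = card S" using sumS[of iS]
    by (simp add: power2_eq_square) (simp add: iS_def)
  define h where "h v = (\<Sum>w\<in>V. B v w * iT w)" for v
  have norm: "(\<Sum>v\<in>V. (h v)\<^sup>2) \<le> l\<^sup>2 * card T"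
    unfolding h_def sqT[symmetric]
  proof (rule symmetric_kernel_norm_le[OF fin])
    show "B v w = B w v" for v w by (simp add: B_def sym[of v w])
  qed (rule B_ev)
  have "(\<Sum>s\<in>S. real (card {t \<in> T. (s, t) \<in> parcs G})) - real d * card S * card T / n
      = (\<Sum>s\<in>S. \<Sum>t\<in>T. B s t)"
    using n by (simp add: B_def sum_subtractf card_eq[OF sub(2)])
  also have "\<dots> = (\<Sum>v\<in>V. iS v * h v)" by (simp add: sumS sumT h_def)
  finally have eq: "(\<Sum>s\<in>S. real (card {t \<in> T. (s, t) \<in> parcs G})) - real d * card S * card T / n
      = (\<Sum>v\<in>V. iS v * h v)" .
  have "(\<Sum>v\<in>V. iS v * h v)\<^sup>2 \<le> (\<Sum>v\<in>V. (iS v)\<^sup>2) * (\<Sum>v\<in>V. (h v)\<^sup>2)"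
    by (rule Cauchy_Schwarz_ineq_sum)
  also have "\<dots> \<le> card S * (l\<^sup>2 * card T)" using norm by (simp add: sqS mult_left_mono)
  also have "\<dots> = (l * sqrt (real (card S) * card T))\<^sup>2" by (simp add: power_mult_distrib)
  finally show ?thesis unfolding eq
    using l by (metis abs_le_square_iff abs_of_nonneg mult_nonneg_nonneg of_nat_0_le_iff real_sqrt_ge_zero)
qed

section \<open>Finding two vertices that realise all four adjacency patterns\<close>

lemma nd_lambda_graph_mono:
  "nd_lambda_graph n d l G \<Longrightarrow> l \<le> l' \<Longrightarrow> nd_lambda_graph n d l' G"
  unfolding nd_lambda_graph_def by (blast intro: order_trans)

text \<open>Squaring a mixing bound cancels one factor \<open>b\<close>. In the applications
  \<open>b\<close> is the size of an exceptional set and \<open>c\<close> the deviation per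
  vertex.\<close>

lemma square_mult_le_of_le_sqrt:
  fixes b c l q :: real
  assumes "c * b \<le> l * sqrt (b * q)" "0 \<le> b" "0 \<le> c" "0 \<le> q"
  shows "c\<^sup>2 * b \<le> l\<^sup>2 * q"
proof (cases "b = 0")
  case False
  have "(c * b)\<^sup>2 \<le> (l * sqrt (b * q))\<^sup>2" using assms by (intro power_mono) auto
  then have "b * (c\<^sup>2 * b) \<le> b * (l\<^sup>2 * q)"
    using assms by (simp add: power_mult_distrib power2_eq_square algebra_simps)
  then show ?thesis using False assms by simp
qed (use assms in simp)

text \<open>A finite form of the result: explicit constants replace the two little-o
  hypotheses.\<close>

lemma exists_shattered_pair:
  fixes G :: "'a pair_pre_digraph"
  assumes G: "nd_lambda_graph n d l G" and l: "0 \<le> l" and U: "U \<subseteq> pverts G"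
    and d: "0 < d" "16 * d \<le> n" and lU: "10 * l * n \<le> real d * card U"
  shows "\<exists>x\<in>U. \<exists>y\<in>U. x \<noteq> y \<and>
    (\<forall>p q. \<exists>v\<in>U. ((x, v) \<in> parcs G \<longleftrightarrow> p) \<and> ((y, v) \<in> parcs G \<longleftrightarrow> q))"
proof -
  interpret pair_graph G using G by (simp add: nd_lambda_graph_def)
  define deg where "deg S v = card {w \<in> S. (v, w) \<in> parcs G}" for S v
  define u where "u = card U"
  have finV: "finite (pverts G)" and cardV: "card (pverts G) = n"
    using G by (auto simp: nd_lambda_graph_def)
  have finU: "finite U" using U finV finite_subset by blast
  have n: "n > 0" using d by simp
  have un: "u \<le> n" unfolding u_def using card_mono[OF finV U] cardV by simp
  have "real d * u \<le> real d * n" using un by (intro mult_left_mono) auto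
  then have "(10 * l) * n \<le> real d * n" using lU by (simp add: u_def)
  then have "10 * l \<le> real d" using n by (subst (asm) mult_le_cancel_right_pos) auto
  then have ld: "l < d" using d l by simp
  have mixing: "\<bar>(\<Sum>s\<in>S. real (deg T s)) - real d * card S * card T / n\<bar>
      \<le> l * sqrt (real (card S) * card T)" if "S \<subseteq> pverts G" "T \<subseteq> pverts G" for S T
    unfolding deg_def using expander_mixing[OF G l ld that] .
  \<comment> \<open>For \<open>l = 0\<close> mixing is exact; between a vertex and its neighbourhood
    it would give \<open>d = n\<close>. Positivity of \<open>l\<close> yields \<open>D > 0\<close>
    and a nonempty \<open>U\<close>.\<close>
  have l0: "l > 0"
  proof (rule ccontr)
    assume "\<not> l > 0"
    then have l': "l = 0" using l by simp
    obtain v where v: "v \<in> pverts G" using n cardV by (metis card.empty ex_in_conv less_irrefl)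
    define N where "N = {w \<in> pverts G. (v, w) \<in> parcs G}"
    have N: "card N = d" unfolding N_def using nd_lambda_graph_card_nbrs[OF G v] .
    have "{w \<in> N. (v, w) \<in> parcs G} = N" by (auto simp: N_def)
    then have "deg N v = d" by (simp add: deg_def N)
    then have "real d = real d * d / n"
      using mixing[of "{v}" N] v N l' by (simp add: N_def)
    then show False using d n by (simp add: field_simps)
  qed
  define D where "D = real d * u / n"
  have lD: "l \<le> D / 10" using lU n by (simp add: D_def u_def field_simps)
  then have D0: "D > 0" using l0 by simp
  have u0: "u > 0" using D0 by (auto simp: D_def intro: gr0I)
  have l2: "l\<^sup>2 \<le> D\<^sup>2 / 100" using power_mono[OF lD l, of 2] by (simp add: power_divide)
  \<comment> \<open>\<open>D\<close> is the expected degree inside \<open>U\<close>; vertices of atypical degree are rare.\<close>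
  define L where "L = {v \<in> U. real (deg U v) < D / 2}"
  define H where "H = {v \<in> U. real (deg U v) > 2 * D}"
  have "card L \<le> real u / 25"
  proof -
    have "(\<Sum>s\<in>L. real (deg U s)) \<le> card L * (D / 2)"
      by (intro sum_bounded_above) (auto simp: L_def)
    moreover have "\<bar>(\<Sum>s\<in>L. real (deg U s)) - D * card L\<bar> \<le> l * sqrt (real (card L) * u)"
      using mixing[of L U] U by (auto simp: L_def D_def u_def mult_ac)
    ultimately have "D / 2 * card L \<le> l * sqrt (real (card L) * u)" by (simp add: algebra_simps)
    then have "(D / 2)\<^sup>2 * card L \<le> l\<^sup>2 * u"
      using D0 by (intro square_mult_le_of_le_sqrt) auto
    also have "\<dots> \<le> D\<^sup>2 / 100 * u" using l2 by (intro mult_right_mono) auto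
    finally have "D\<^sup>2 * card L \<le> D\<^sup>2 * (real u / 25)" by (simp add: power_divide algebra_simps)
    then show ?thesis using D0 by (subst (asm) mult_le_cancel_left_pos) auto
  qed
  moreover have "card H \<le> real u / 100"
  proof -
    have "(\<Sum>s\<in>H. real (deg U s)) \<ge> card H * (2 * D)"
      by (intro sum_bounded_below) (auto simp: H_def)
    moreover have "\<bar>(\<Sum>s\<in>H. real (deg U s)) - D * card H\<bar> \<le> l * sqrt (real (card H) * u)"
      using mixing[of H U] U by (auto simp: H_def D_def u_def mult_ac)
    ultimately have "D * card H \<le> l * sqrt (real (card H) * u)" by (simp add: algebra_simps)
    then have "D\<^sup>2 * card H \<le> l\<^sup>2 * u"
      using D0 by (intro square_mult_le_of_le_sqrt) auto
    also have "\<dots> \<le> D\<^sup>2 / 100 * u" using l2 by (intro mult_right_mono) auto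
    finally have "D\<^sup>2 * card H \<le> D\<^sup>2 * (real u / 100)" by simp
    then show ?thesis using D0 by (subst (asm) mult_le_cancel_left_pos) auto
  qed
  moreover define T where "T = U - (L \<union> H)"
  have TU: "T \<subseteq> U" by (auto simp: T_def)
  have "u \<le> card T + (card L + card H)"
  proof -
    have "U \<subseteq> T \<union> (L \<union> H)" by (auto simp: T_def)
    then have "u \<le> card (T \<union> (L \<union> H))"
      unfolding u_def using finU by (intro card_mono) (auto simp: T_def L_def H_def)
    also have "\<dots> \<le> card T + (card L + card H)"
      by (meson add_left_mono card_Un_le order_trans)
    finally show ?thesis .
  qed
  \<comment> \<open>The fraction is 1 - 1/25 - 1/100.\<close>
  ultimately have cardT: "card T \<ge> 19 / 20 * real u" by linarith
  have Tpos: "card T > 0" using cardT u0 by (intro gr0I) auto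
  have degT: "D / 2 \<le> real (deg U v)" "real (deg U v) \<le> 2 * D" if "v \<in> T" for v
    using that by (auto simp: T_def L_def H_def)
  \<comment> \<open>Otherwise mixing \<open>T\<close> with itself gives 19/20 \<open>D\<close> at
    most \<open>D / 2 + l\<close>, hence at most 3/5 \<open>D\<close>.\<close>
  obtain v where v: "v \<in> T" "D / 2 \<le> real (deg T v)"
  proof (rule ccontr)
    assume "\<not> thesis"
    then have "(\<Sum>s\<in>T. real (deg T s)) \<le> card T * (D / 2)"
      using that by (intro sum_bounded_above) force
    moreover have "\<bar>(\<Sum>s\<in>T. real (deg T s)) - real d * card T * card T / n\<bar> \<le> l * card T"
      using mixing[of T T] TU U by auto
    ultimately have "real d * card T * card T / n \<le> card T * (D / 2 + l)"
      by (simp add: algebra_simps)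
    moreover have "real d * card T * card T / n = card T * (real d * card T / n)" by simp
    ultimately have "real d * card T / n \<le> D / 2 + l"
      using Tpos by (metis mult_le_cancel_left_pos of_nat_0_less_iff)
    moreover have "real d * (19 / 20 * real u) / n \<le> real d * card T / n"
      using cardT n by (intro divide_right_mono mult_left_mono) auto
    then have "19 / 20 * D \<le> real d * card T / n" by (simp add: D_def)
    ultimately show False using lD D0 by linarith
  qed
  have "deg T v > 0" using v D0 by (intro gr0I) auto
  then obtain x where x: "x \<in> T" "(v, x) \<in> parcs G" by (auto simp: deg_def card_gt_0_iff)
  define N where "N = {w \<in> U. (x, w) \<in> parcs G}"
  have cardN: "card N = deg U x" by (simp add: N_def deg_def)
  define B where "B = {y \<in> U. D / 2 \<le> real (deg N y)}"
  \<comment> \<open>Since \<open>N\<close> has at most \<open>2 * D\<close> elements and density is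
    at most 1/16, the expected degree into \<open>N\<close> is at most \<open>D / 8\<close>. Each
    vertex of \<open>B\<close> exceeds this by at least 3/8 \<open>D\<close>.\<close>
  have "card B < D / 2"
  proof -
    have "(\<Sum>s\<in>B. real (deg N s)) \<ge> card B * (D / 2)"
      by (intro sum_bounded_below) (auto simp: B_def)
    moreover have "\<bar>(\<Sum>s\<in>B. real (deg N s)) - real d * card B * card N / n\<bar>
        \<le> l * sqrt (real (card B) * card N)"
      using mixing[of B N] U by (auto simp: B_def N_def)
    moreover have "real d * card B * card N / n \<le> card B * (D / 8)"
    proof -
      have "real d / n \<le> 1 / 16" using d n by (simp add: field_simps)
      then have "real d / n * card N \<le> 1 / 16 * (2 * D)"
        using degT(2)[OF x(1)] by (intro mult_mono) (auto simp: cardN)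
      then have "card B * (real d / n * card N) \<le> card B * (D / 8)" by (intro mult_left_mono) auto
      then show ?thesis by (simp add: mult_ac)
    qed
    ultimately have "3 / 8 * D * card B \<le> l * sqrt (real (card B) * card N)"
      by argo
    then have "(3 / 8 * D)\<^sup>2 * card B \<le> l\<^sup>2 * card N"
      using D0 by (intro square_mult_le_of_le_sqrt) auto
    also have "\<dots> \<le> D\<^sup>2 / 100 * (2 * D)"
      using l2 degT(2)[OF x(1)] by (intro mult_mono) (auto simp: cardN)
    also have "(3 / 8 * D)\<^sup>2 * card B = D\<^sup>2 * (9 / 64 * card B)"
      by (simp add: power2_eq_square)
    also have "D\<^sup>2 / 100 * (2 * D) = D\<^sup>2 * (D / 50)" by simp
    finally have "D\<^sup>2 * (9 / 64 * card B) \<le> D\<^sup>2 * (D / 50)" .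
    then have "9 / 64 * card B \<le> D / 50" using D0 by (subst (asm) mult_le_cancel_left_pos) auto
    then show ?thesis using D0 by linarith
  qed
  \<comment> \<open>\<open>x\<close> itself lies in \<open>B\<close>, so the vertex \<open>y\<close> obtained here differs from \<open>x\<close>.\<close>
  then have "card B < deg T v" using v by linarith
  then have "\<not> {w \<in> T. (v, w) \<in> parcs G} \<subseteq> B"
    using card_mono[of B "{w \<in> T. (v, w) \<in> parcs G}"] finU by (auto simp: deg_def B_def)
  then obtain y where y: "y \<in> T" "(v, y) \<in> parcs G" "y \<notin> B" by blast
  have xyU: "x \<in> U" "y \<in> U" "v \<in> U" using x y v TU by auto
  define N' where "N' = {w \<in> U. (y, w) \<in> parcs G}"
  have cardN': "card N' = deg U y" by (simp add: N'_def deg_def)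
  have finN: "finite N" "finite N'" using finU by (auto simp: N_def N'_def)
  have inter: "card (N \<inter> N') < D / 2"
  proof -
    have "N \<inter> N' = {w \<in> N. (y, w) \<in> parcs G}" by (auto simp: N_def N'_def)
    then show ?thesis using y xyU by (auto simp: B_def deg_def)
  qed
  \<comment> \<open>Both neighbourhoods have at least \<open>D / 2\<close> elements, more than their
    intersection. The digits in \<open>v10\<close>, \<open>v01\<close>, \<open>v00\<close> record
    adjacency to \<open>x\<close> and to \<open>y\<close>.\<close>
  have "\<not> N \<subseteq> N'"
    using inter degT(1)[OF x(1)] by (auto simp: Int_absorb2 cardN)
  then obtain v10 where v10: "v10 \<in> N" "v10 \<notin> N'" by blast
  have "\<not> N' \<subseteq> N"
    using inter degT(1)[OF y(1)] by (auto simp: Int_absorb1 cardN')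
  then obtain v01 where v01: "v01 \<in> N'" "v01 \<notin> N" by blast
  have "\<not> U \<subseteq> N \<union> N'"
  proof
    assume "U \<subseteq> N \<union> N'"
    then have "u \<le> card (N \<union> N')" unfolding u_def using finN by (intro card_mono) auto
    also have "\<dots> \<le> card N + card N'" by (rule card_Un_le)
    finally have "real u \<le> 4 * D" using degT(2)[OF x(1)] degT(2)[OF y(1)] by (simp add: cardN cardN')
    also have "\<dots> = 4 * d * u / n" by (simp add: D_def)
    also have "\<dots> < real u" using d n u0 by (simp add: field_simps)
    finally show False by simp
  qed
  then obtain v00 where v00: "v00 \<in> U" "v00 \<notin> N" "v00 \<notin> N'" by blast
  have v11: "v \<in> N" "v \<in> N'"
    using xyU x y arcs_symmetric by (auto simp: N_def N'_def)
  have "x \<noteq> y" using v10 by (auto simp: N_def N'_def)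
  moreover have "\<exists>v\<in>U. ((x, v) \<in> parcs G \<longleftrightarrow> p) \<and> ((y, v) \<in> parcs G \<longleftrightarrow> q)" for p q
    using v00 v01 v10 v11 by (cases p; cases q) (auto simp: N_def N'_def)
  ultimately show ?thesis using xyU by blast
qed

section \<open>From adjacency patterns to the VC-dimension and the asymptotic statement\<close>

text \<open>The restriction of \<open>nbr_fun G U v\<close> to the pair records the adjacencies of
  \<open>v\<close> to \<open>x\<close> and \<open>y\<close>, so the four patterns are the four
  functions to be realised.\<close>

lemma vc_dim_ge_2:
  assumes xy: "x \<in> U" "y \<in> U" "x \<noteq> y"
    and pat: "\<forall>p q. \<exists>v\<in>U. ((x, v) \<in> parcs G \<longleftrightarrow> p) \<and> ((y, v) \<in> parcs G \<longleftrightarrow> q)"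
  shows "vc_dim U (nbr_class G U) \<ge> 2"
proof -
  have "shatters (nbr_class G U) {x, y}"
    unfolding shatters_def
  proof (intro conjI equalityI subsetI)
    fix h assume "h \<in> (\<lambda>h. restrict h {x, y}) ` nbr_class G U"
    then show "h \<in> {x, y} \<rightarrow>\<^sub>E {0, 1}" using xy by (auto simp: nbr_class_def nbr_fun_def split: if_splits)
  next
    fix h :: "'a \<Rightarrow> nat" assume h: "h \<in> {x, y} \<rightarrow>\<^sub>E {0, 1}"
    obtain v where v: "v \<in> U" "(x, v) \<in> parcs G \<longleftrightarrow> h x = 1" "(y, v) \<in> parcs G \<longleftrightarrow> h y = 1"
      using pat by blast
    have "h = restrict (nbr_fun G U v) {x, y}"
      using h v xy by (intro ext) (auto simp: nbr_fun_def restrict_def PiE_iff extensional_def)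
    then show "h \<in> (\<lambda>h. restrict h {x, y}) ` nbr_class G U"
      using v by (auto simp: nbr_class_def)
  qed simp
  then have "enat (card {x, y}) \<le> vc_dim U (nbr_class G U)"
    unfolding vc_dim_def using xy by (intro SUP_upper) auto
  then show ?thesis using xy by (simp add: numeral_eq_enat numeral_2_eq_2)
qed

theorem theorem1p4:
  fixes G :: "nat \<Rightarrow> 'a pair_pre_digraph"
    and n d :: "nat \<Rightarrow> nat"
    and l :: "nat \<Rightarrow> real"
    and U :: "nat \<Rightarrow> 'a set"
  assumes "\<And>k. nd_lambda_graph (n k) (d k) (l k) (G k)"
    and "\<And>k. d k > 0"
    and "\<And>k. U k \<subseteq> pverts (G k)"
    and "filterlim n at_top sequentially"
    and "(\<lambda>k. real (d k)) \<in> o(\<lambda>k. real (n k))"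
    and "(\<lambda>k. l k * real (n k) / real (d k)) \<in> o(\<lambda>k. real (card (U k)))"
  shows "\<forall>\<^sub>F k in sequentially. vc_dim (U k) (nbr_class (G k) (U k)) \<ge> 2"
proof -
  have "\<forall>\<^sub>F k in sequentially. norm (real (d k)) \<le> 1 / 16 * norm (real (n k))"
    using assms(5) by (rule landau_o.smallD) simp
  moreover have "\<forall>\<^sub>F k in sequentially.
      norm (l k * real (n k) / real (d k)) \<le> 1 / 10 * norm (real (card (U k)))"
    using assms(6) by (rule landau_o.smallD) simp
  ultimately show ?thesis
  proof eventually_elim
    case (elim k)
    \<comment> \<open>The sign of \<open>l k\<close> is not prescribed, so \<open>l k\<close> is
      raised to a nonnegative bound before the finite statement is applied.\<close>
    have "nd_lambda_graph (n k) (d k) (max 0 (l k)) (G k)"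
      using assms(1) by (rule nd_lambda_graph_mono) simp
    moreover have "16 * d k \<le> n k" using elim(1) by simp
    moreover have "10 * max 0 (l k) * n k \<le> real (d k) * card (U k)"
    proof (cases "l k \<ge> 0")
      case True
      then show ?thesis using elim(2) assms(2)[of k] by (simp add: field_simps)
    qed simp
    ultimately have "\<exists>x\<in>U k. \<exists>y\<in>U k. x \<noteq> y \<and>
        (\<forall>p q. \<exists>v\<in>U k. ((x, v) \<in> parcs (G k) \<longleftrightarrow> p) \<and> ((y, v) \<in> parcs (G k) \<longleftrightarrow> q))"
      by (rule exists_shattered_pair[OF _ max.cobounded1 assms(3) assms(2)])
    then show ?case by (elim bexE conjE) (rule vc_dim_ge_2)
  qed
qed

end
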